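(* Let $\mathscr D=\{d_1,\ldots,d_n\}$ be a set of positive integers with $d_1>d_2>\cdots>d_n$ and $\min\mathscr D=d_n=2$. Define $C^{\star}$ as follows. If $\sigma(\mathscr D)$ is even: let $\mathbf s=d_1,\ldots,d_n$, $c=\max_{1\le k\le n-1}\left\lceil \frac{-\Delta_{\mathbf s}(k)}{\min\{k,2\}}\right\rceil$, and $C^{\star}=c$. If $\sigma(\mathscr D)$ is odd: let $r=\max\{i: d_i\text{ is odd}\}$, let $\mathbf s=d_1,\ldots,d_{r-1},(d_r)_2,d_{r+1},\ldots,d_n$, and $C^{\star}=\max_{1\le k\le n}\left\lceil \frac{-\Delta_{\mathbf s}(k)}{\min\{k,2\}}\right\rceil$. Then \[ \ell_q(\mathscr D)=\tfrac12\big(\sigma(\mathscr D)+2C^{\star}\big)+\begin{cases}0 & \text{if }\sigma(\mathscr D)\text{ is even};\\ \tfrac12 d_r & \text{if }\sigma(\mathscr D)\text{ is odd}.\end{cases} \]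
   Context: All graphs are finite and simple. The degree set of a graph $G$ is the set of distinct degrees of its vertices. For a finite nonempty set $\mathscr D$ of positive integers, $\ell_q(\mathscr D)$ denotes the least number of edges of a simple graph whose degree set is exactly $\mathscr D$. $\sigma(\mathscr D)$ is the sum of the elements of $\mathscr D$. The notation $(d)_m$ denotes $m$ consecutive occurrences of $d$ in a sequence. For a sequence $\mathbf s=a_1,\ldots,a_p$ and $1\le k\le p$, define $\Delta_{\mathbf s}(k)=k(k-1)+\sum_{i=k+1}^{p}\min\{k,a_i\}-\sum_{i=1}^{k}a_i$.
   Formalization: The formal statement assumes n ≥ 2: for n = 1, i.e. D = {2}, the maximum over 1 ≤ k ≤ n−1 defining C* is over an empty set, so C* is undefined (the true value ℓ_q({2}) = 3 would require C* = 2). *)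

theory Defs
  imports Complex_Main
begin

definition simple_graph :: "'a set \<Rightarrow> 'a set set \<Rightarrow> bool" where
  "simple_graph V E \<longleftrightarrow> finite V \<and> (\<forall>e\<in>E. e \<subseteq> V \<and> card e = 2)"

definition degree :: "'a set set \<Rightarrow> 'a \<Rightarrow> nat" where
  "degree E v = card {e \<in> E. v \<in> e}"

definition degree_set :: "'a set \<Rightarrow> 'a set set \<Rightarrow> nat set" where
  "degree_set V E = degree E ` V"

text \<open>Vertices are taken to be natural numbers. This loses nothing, since every finite graph is
  isomorphic to one on natural numbers: see \<open>ell_q_le\<close> and \<open>ell_q_attained\<close> below.\<close>

definition ell_q :: "nat set \<Rightarrow> nat" where
  "ell_q D = (LEAST m. \<exists>(V :: nat set) E. simple_graph V E \<and> degree_set V E = D \<and> card E = m)"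

lemma simple_graph_nat_copy:
  fixes V :: "'a set"
  assumes "simple_graph V E"
  shows "\<exists>(V' :: nat set) E'. simple_graph V' E' \<and> degree_set V' E' = degree_set V E \<and> card E' = card E"
proof -
  have fin: "finite V" and edges: "\<And>e. e \<in> E \<Longrightarrow> e \<subseteq> V \<and> card e = 2"
    using assms by (auto simp: simple_graph_def)
  obtain f :: "'a \<Rightarrow> nat" where f: "inj_on f V"
    using finite_imp_inj_to_nat_seg[OF fin] by blast
  have inj: "inj_on (image f) E"
    by (rule inj_on_subset[OF inj_on_image_Pow[OF f]]) (use edges in auto)
  have deg: "degree (image f ` E) (f v) = degree E v" if "v \<in> V" for v
  proof -
    have "{e \<in> image f ` E. f v \<in> e} = image f ` {e \<in> E. v \<in> e}"
    proof (intro equalityI subsetI)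
      fix e' assume "e' \<in> {e \<in> image f ` E. f v \<in> e}"
      then obtain e where e: "e \<in> E" "e' = f ` e" "f v \<in> f ` e" by blast
      then have "v \<in> e" using edges inj_on_image_mem_iff[OF f that] by simp
      then show "e' \<in> image f ` {e \<in> E. v \<in> e}" using e by simp
    qed auto
    moreover have "inj_on (image f) {e \<in> E. v \<in> e}"
      by (rule inj_on_subset[OF inj]) auto
    ultimately show ?thesis
      by (simp add: degree_def card_image)
  qed
  have "simple_graph (f ` V) (image f ` E)"
    unfolding simple_graph_def
  proof (intro conjI ballI)
    fix e' assume "e' \<in> image f ` E"
    then obtain e where e: "e \<in> E" "e' = f ` e" by blast
    then show "e' \<subseteq> f ` V" using edges by blast
    show "card e' = 2"
      using e edges by (metis card_image f inj_on_subset)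
  qed (use fin in auto)
  moreover have "degree_set (f ` V) (image f ` E) = degree_set V E"
    using deg by (simp add: degree_set_def image_image)
  moreover have "card (image f ` E) = card E"
    using inj by (rule card_image)
  ultimately show ?thesis by blast
qed

lemma ell_q_le:
  fixes V :: "'a set"
  assumes "simple_graph V E"
  shows "ell_q (degree_set V E) \<le> card E"
  unfolding ell_q_def by (rule Least_le) (rule simple_graph_nat_copy[OF assms])

lemma ell_q_attained:
  fixes V :: "'a set"
  assumes "simple_graph V E"
  shows "\<exists>(V' :: nat set) E'. simple_graph V' E' \<and> degree_set V' E' = degree_set V E
           \<and> card E' = ell_q (degree_set V E)"
proof -
  let ?P = "\<lambda>m. \<exists>(V' :: nat set) E'. simple_graph V' E' \<and> degree_set V' E' = degree_set V E \<and> card E' = m"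
  have "?P (card E)" by (rule simple_graph_nat_copy[OF assms])
  then have "?P (Least ?P)" by (rule LeastI)
  then show ?thesis unfolding ell_q_def .
qed

definition sigma :: "nat set \<Rightarrow> nat" where
  "sigma D = \<Sum>D"

text \<open>The term \<open>a\<^sub>i\<close> of the sequence \<open>s = a\<^sub>1, \<dots>, a\<^sub>p\<close> is \<open>s ! (i - 1)\<close>.\<close>

definition Delta :: "nat list \<Rightarrow> nat \<Rightarrow> int" where
  "Delta s k = int k * (int k - 1) + (\<Sum>i = k + 1..length s. int (min k (s ! (i - 1))))
                 - (\<Sum>i = 1..k. int (s ! (i - 1)))"

text \<open>In what follows the set is \<open>{d 1, \<dots>, d n}\<close> with \<open>d 1 > \<dots> > d n\<close>; the value \<open>d 0\<close> plays
  no role.\<close>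

definition last_odd :: "(nat \<Rightarrow> nat) \<Rightarrow> nat \<Rightarrow> nat" where
  "last_odd d n = Max {i \<in> {1..n}. odd (d i)}"

definition seq_even :: "(nat \<Rightarrow> nat) \<Rightarrow> nat \<Rightarrow> nat list" where
  "seq_even d n = map d [1..<n + 1]"

definition seq_odd :: "(nat \<Rightarrow> nat) \<Rightarrow> nat \<Rightarrow> nat list" where
  "seq_odd d n = (let r = last_odd d n in
     map d [1..<r] @ replicate 2 (d r) @ map d [r + 1..<n + 1])"

definition C_star :: "(nat \<Rightarrow> nat) \<Rightarrow> nat \<Rightarrow> int" where
  "C_star d n =
     (if even (sigma (d ` {1..n}))
      then Max ((\<lambda>k. \<lceil>- real_of_int (Delta (seq_even d n) k) / real (min k 2)\<rceil>) ` {1..n - 1})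
      else Max ((\<lambda>k. \<lceil>- real_of_int (Delta (seq_odd d n) k) / real (min k 2)\<rceil>) ` {1..n}))"

end

theory Submission
  imports Defs
begin

text \<open>A graph with degree set \<open>D\<close> contains a vertex of every degree in \<open>D\<close>; if \<open>\<sigma>(D)\<close> is odd, the
  handshake lemma forces a further vertex of odd degree, which is at least \<open>d\<^sub>r\<close>. So its degree sequence
  is \<open>s\<close> (up to an excess at that vertex) together with extra entries, all at least \<open>2\<close>. Counting the
  degrees of the vertices belonging to the first \<open>k\<close> entries of \<open>s\<close> shows that excess plus extra entries
  sum to at least \<open>2 \<lceil>-\<Delta>\<^sub>s(k) / min k 2\<rceil>\<close> for every \<open>k\<close>, hence to at least \<open>2 C\<^sup>\<star>\<close>.
  Conversely, appending \<open>C\<^sup>\<star>\<close> copies of \<open>2\<close> to \<open>s\<close> yields a graphic sequence by the Erdos--Gallai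
  theorem: for \<open>k < length s\<close> the inequality is the definition of \<open>C\<^sup>\<star>\<close>, and beyond that, where only
  twos follow, \<open>\<Delta>\<close> does not decrease once \<open>k \<ge> 2\<close>.

  The sufficiency half of Erdos--Gallai follows the argument of Tripathi, Venugopalan and West, which
  saturates the vertices one after another by local edge exchanges.\<close>

section \<open>Degree counts in simple graphs\<close>

definition nbrs :: "'a set set \<Rightarrow> 'a \<Rightarrow> 'a set" where
  "nbrs E v = {u. {u, v} \<in> E}"

lemma simple_graph_finite: "simple_graph V E \<Longrightarrow> finite E"
  unfolding simple_graph_def by (rule finite_subset[of _ "Pow V"]) auto

lemma simple_graph_edge:
  assumes "simple_graph V E" and "{a, b} \<in> E"
  shows "a \<in> V" "b \<in> V" "a \<noteq> b"
proof -
  have "{a, b} \<subseteq> V" "card {a, b} = 2" using assms by (auto simp: simple_graph_def)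
  then show "a \<in> V" "b \<in> V" "a \<noteq> b" by auto
qed

lemma simple_graph_insert:
  assumes "simple_graph V E" "a \<in> V" "b \<in> V" "a \<noteq> b"
  shows "simple_graph V (insert {a, b} E)"
  using assms by (auto simp: simple_graph_def)

lemma simple_graph_Diff: "simple_graph V E \<Longrightarrow> simple_graph V (E - F)"
  by (auto simp: simple_graph_def)

lemma nbrs_subset: "simple_graph V E \<Longrightarrow> nbrs E v \<subseteq> V - {v}"
  by (auto simp: nbrs_def dest: simple_graph_edge)

lemma finite_nbrs: "simple_graph V E \<Longrightarrow> finite (nbrs E v)"
  using nbrs_subset by (metis finite_Diff finite_subset simple_graph_def)

lemma degree_eq_card_nbrs:
  assumes "simple_graph V E"
  shows "degree E v = card (nbrs E v)"
proof -
  have "{e \<in> E. v \<in> e} = (\<lambda>u. {u, v}) ` nbrs E v"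
  proof (intro equalityI subsetI)
    fix e assume e: "e \<in> {e \<in> E. v \<in> e}"
    then have "card e = 2" using assms by (auto simp: simple_graph_def)
    then obtain a b where "e = {a, b}" by (meson card_2_iff)
    then show "e \<in> (\<lambda>u. {u, v}) ` nbrs E v"
      using e by (auto simp: nbrs_def insert_commute)
  qed (auto simp: nbrs_def)
  moreover have "inj_on (\<lambda>u. {u, v}) (nbrs E v)"
    by (auto simp: inj_on_def doubleton_eq_iff)
  ultimately show ?thesis by (simp add: degree_def card_image)
qed

lemma degree_insert:
  assumes "finite E" "{a, b} \<notin> E"
  shows "degree (insert {a, b} E) x = degree E x + (if x = a \<or> x = b then 1 else 0)"
proof -
  have "{e \<in> insert {a, b} E. x \<in> e} =
      (if x = a \<or> x = b then insert {a, b} {e \<in> E. x \<in> e} else {e \<in> E. x \<in> e})" by auto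
  then show ?thesis using assms by (simp add: degree_def)
qed

lemma degree_Diff:
  assumes "finite E" "{a, b} \<in> E"
  shows "degree (E - {{a, b}}) x = degree E x - (if x = a \<or> x = b then 1 else 0)"
proof -
  have "{e \<in> E - {{a, b}}. x \<in> e} = {e \<in> E. x \<in> e} - (if x = a \<or> x = b then {{a, b}} else {})"
    by auto
  then show ?thesis using assms by (simp add: degree_def)
qed

lemma degree_pos:
  assumes "finite E" "{a, b} \<in> E"
  shows "0 < degree E a" "0 < degree E b"
  using assms by (auto simp: degree_def card_gt_0_iff)

text \<open>Handshake lemma: both sides count the incident pairs of a vertex and an edge.\<close>

lemma sum_degree:
  assumes "simple_graph V E"
  shows "(\<Sum>v\<in>V. degree E v) = 2 * card E"
proof -
  have fin: "finite V" "finite E" using assms simple_graph_finite by (auto simp: simple_graph_def)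
  have "(\<Sum>v\<in>V. degree E v) = (\<Sum>v\<in>V. \<Sum>e\<in>{e \<in> E. v \<in> e}. 1)"
    by (simp add: degree_def)
  also have "\<dots> = (\<Sum>e\<in>E. \<Sum>v\<in>{v \<in> V. v \<in> e}. (1::nat))"
    by (rule sum.swap_restrict[OF fin])
  also have "\<dots> = (\<Sum>e\<in>E. 2)"
  proof (rule sum.cong)
    fix e assume "e \<in> E"
    then have "{v \<in> V. v \<in> e} = e" "card e = 2" using assms by (auto simp: simple_graph_def)
    then show "(\<Sum>v\<in>{v \<in> V. v \<in> e}. 1) = (2::nat)" by simp
  qed simp
  finally show ?thesis by simp
qed

text \<open>Edges leaving \<open>K\<close> are counted from their outer endpoints instead of their
  inner ones. An exact identity is kept because it serves both the necessary inequality below and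
  the tight case of the exchange argument.\<close>

lemma sum_degree_split:
  assumes G: "simple_graph V E" and K: "K \<subseteq> V"
  shows "(\<Sum>v\<in>K. degree E v) =
    (\<Sum>v\<in>K. card (nbrs E v \<inter> K)) + (\<Sum>v\<in>V - K. card (nbrs E v \<inter> K))"
proof -
  have fin: "finite V" "finite K" using G K finite_subset by (auto simp: simple_graph_def)
  have "degree E v = card (nbrs E v \<inter> K) + card (nbrs E v \<inter> (V - K))" if "v \<in> K" for v
  proof -
    have "nbrs E v = (nbrs E v \<inter> K) \<union> (nbrs E v \<inter> (V - K))" using nbrs_subset[OF G] by blast
    moreover have "card \<dots> = card (nbrs E v \<inter> K) + card (nbrs E v \<inter> (V - K))"
      by (rule card_Un_disjoint) (use fin in auto)
    ultimately show ?thesis using degree_eq_card_nbrs[OF G] by metis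
  qed
  then have "(\<Sum>v\<in>K. degree E v) =
      (\<Sum>v\<in>K. card (nbrs E v \<inter> K)) + (\<Sum>v\<in>K. card (nbrs E v \<inter> (V - K)))"
    by (simp add: sum.distrib)
  also have "(\<Sum>v\<in>K. card (nbrs E v \<inter> (V - K))) = (\<Sum>v\<in>K. \<Sum>u\<in>{u \<in> V - K. {u, v} \<in> E}. 1)"
    by (intro sum.cong) (auto simp: nbrs_def intro!: arg_cong[where f = card])
  also have "\<dots> = (\<Sum>u\<in>V - K. \<Sum>v\<in>{v \<in> K. {u, v} \<in> E}. 1)"
    by (rule sum.swap_restrict) (use fin in auto)
  also have "\<dots> = (\<Sum>v\<in>V - K. card (nbrs E v \<inter> K))"
    by (intro sum.cong) (auto simp: nbrs_def insert_commute intro!: arg_cong[where f = card])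
  finally show ?thesis .
qed

text \<open>The necessary half of Erdos-Gallai, for an arbitrary vertex set \<open>K\<close> rather
  than the vertices of largest degree: a vertex of \<open>K\<close> has at most
  \<open>card K - 1\<close> neighbours inside \<open>K\<close>, and no vertex outside exceeds
  \<open>card K\<close> or its own degree.\<close>

lemma sum_degree_le:
  assumes G: "simple_graph V E" and K: "K \<subseteq> V"
  shows "(\<Sum>v\<in>K. degree E v) \<le> card K * (card K - 1) + (\<Sum>v\<in>V - K. min (card K) (degree E v))"
proof -
  have fin: "finite V" "finite K" using G K finite_subset by (auto simp: simple_graph_def)
  have "card (nbrs E v \<inter> K) \<le> card K - 1" if "v \<in> K" for v
  proof -
    have "nbrs E v \<inter> K \<subseteq> K - {v}" using nbrs_subset[OF G] by blast
    then have "card (nbrs E v \<inter> K) \<le> card (K - {v})" using fin by (intro card_mono) auto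
    then show ?thesis using that fin by simp
  qed
  then have "(\<Sum>v\<in>K. card (nbrs E v \<inter> K)) \<le> (\<Sum>v\<in>K. card K - 1)" by (rule sum_mono)
  moreover have "(\<Sum>v\<in>V - K. card (nbrs E v \<inter> K)) \<le> (\<Sum>v\<in>V - K. min (card K) (degree E v))"
    by (rule sum_mono) (auto simp: degree_eq_card_nbrs[OF G] fin finite_nbrs[OF G] intro!: card_mono)
  ultimately show ?thesis unfolding sum_degree_split[OF G K] by simp
qed

text \<open>Source of all exchanges below: replacing \<open>{u, i}\<close> by \<open>{u, r}\<close>
  moves one unit of degree from \<open>i\<close> to \<open>r\<close> and leaves \<open>u\<close>
  unchanged.\<close>

lemma exists_private_neighbour:
  assumes G: "simple_graph V E" and less: "degree E r < degree E i"
  obtains u where "{u, i} \<in> E" "{u, r} \<notin> E" "u \<noteq> r"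
proof -
  have "\<exists>u. {u, i} \<in> E \<and> {u, r} \<notin> E \<and> u \<noteq> r"
  proof (rule ccontr)
    assume "\<not> ?thesis"
    then have sub: "nbrs E i \<subseteq> insert r (nbrs E r)" by (auto simp: nbrs_def)
    note less' = less[unfolded degree_eq_card_nbrs[OF G]]
    show False
    proof (cases "r \<in> nbrs E i")
      case False
      then have "card (nbrs E i) \<le> card (nbrs E r)"
        using sub finite_nbrs[OF G] by (intro card_mono) auto
      then show False using less' by simp
    next
      \<comment> \<open>Here \<open>i\<close> and \<open>r\<close> are adjacent, so each is removed
        from the other's neighbourhood before the cardinalities are compared.\<close>
      case True
      then have i: "i \<in> nbrs E r" by (simp add: nbrs_def insert_commute)
      have "nbrs E i - {r} \<subseteq> nbrs E r - {i}" using sub nbrs_subset[OF G] by blast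
      then have "card (nbrs E i - {r}) \<le> card (nbrs E r - {i})"
        using finite_nbrs[OF G] by (intro card_mono) auto
      moreover have "0 < card (nbrs E r)" using i finite_nbrs[OF G] card_gt_0_iff by blast
      ultimately show False using less' True i finite_nbrs[OF G] by simp
    qed
  qed
  then show thesis using that by blast
qed

section \<open>Sufficiency of the Erdos--Gallai inequalities\<close>

text \<open>The vertices before \<open>r\<close> are saturated; independence of the vertices after \<open>r\<close> is what makes their
  degrees at most \<open>r\<close>, so that a stuck configuration attains equality in the inequality for \<open>k = r\<close>.\<close>

definition subrealization :: "nat \<Rightarrow> (nat \<Rightarrow> nat) \<Rightarrow> nat \<Rightarrow> nat set set \<Rightarrow> bool" where
  "subrealization p f r E \<longleftrightarrow> simple_graph {1..p} E \<and> (\<forall>i\<in>{1..p}. degree E i \<le> f i) \<and>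
     (\<forall>i\<in>{1..<r}. degree E i = f i) \<and> (\<forall>i j. r < i \<longrightarrow> r < j \<longrightarrow> {i, j} \<notin> E)"

text \<open>If nothing raises the degree of \<open>r\<close>, the graph is rigid: \<open>c1\<close>
  and \<open>c3\<close> make \<open>{1..r}\<close> a clique, and \<open>c2\<close> gives every later
  vertex \<open>k\<close> exactly \<open>min r (f k)\<close> neighbours, all in
  \<open>{1..r}\<close>. The degrees in \<open>{1..r}\<close> then sum to the right-hand side of
  \<open>EG\<close>, although \<open>r\<close> falls short of \<open>f r\<close>.\<close>

lemma subrealization_step:
  assumes anti: "\<And>i j. 1 \<le> i \<Longrightarrow> i \<le> j \<Longrightarrow> j \<le> p \<Longrightarrow> f j \<le> f i"
    and ev: "even (\<Sum>i=1..p. f i)"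
    and EG: "(\<Sum>i=1..r. f i) \<le> r * (r - 1) + (\<Sum>i=r+1..p. min r (f i))"
    and r: "1 \<le> r" "r \<le> p"
    and sub: "subrealization p f r E"
    and def: "degree E r < f r"
  shows "\<exists>E'. subrealization p f r E' \<and> degree E r < degree E' r"
proof (rule ccontr)
  assume no: "\<not> ?thesis"
  have G: "simple_graph {1..p} E" and le: "\<And>i. 1 \<le> i \<Longrightarrow> i \<le> p \<Longrightarrow> degree E i \<le> f i"
    and eq: "\<And>i. 1 \<le> i \<Longrightarrow> i < r \<Longrightarrow> degree E i = f i"
    and ind: "\<And>i j. r < i \<Longrightarrow> r < j \<Longrightarrow> {i, j} \<notin> E"
    using sub by (auto simp: subrealization_def)
  have fin: "finite E" using simple_graph_finite[OF G] .
  have deg_less: "degree E r < degree E i" if "1 \<le> i" "i < r" for i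
    using anti[of i r] eq[OF that] def that r by simp
  have edgeI: "1 \<le> a \<and> a \<le> p \<and> 1 \<le> b \<and> b \<le> p \<and> a \<noteq> b" if "{a, b} \<in> E" for a b
    using simple_graph_edge[OF G that] by auto
  have c0: "{k, r} \<in> E" if k: "r < k" "k \<le> p" "degree E k < f k" for k
  proof (rule ccontr)
    assume n: "{k, r} \<notin> E"
    let ?E = "insert {k, r} E"
    have d: "degree ?E x = degree E x + (if x = k \<or> x = r then 1 else 0)" for x
      using degree_insert[OF fin n] .
    have "subrealization p f r ?E"
      unfolding subrealization_def
      using simple_graph_insert[OF G, of k r] k r le eq ind def
      by (auto simp: d doubleton_eq_iff Suc_le_eq)
    then show False using no d[of r] by auto
  qed
  have c1: "{i, r} \<in> E" if i: "1 \<le> i" "i < r" for i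
  proof (rule ccontr)
    assume n: "{i, r} \<notin> E"
    obtain u where u: "{u, i} \<in> E" "{u, r} \<notin> E" "u \<noteq> r"
      using exists_private_neighbour[OF G deg_less[OF i]] by blast
    note ub = edgeI[OF u(1)]
    show False
    proof (cases "degree E r + 2 \<le> f r")
      case True
      \<comment> \<open>Rerouting \<open>{u, i}\<close> through \<open>r\<close> preserves the
        degrees of \<open>u\<close> and \<open>i\<close> but adds two at \<open>r\<close>, hence the
        case distinction on the deficit.\<close>
      let ?E = "insert {u, r} (insert {i, r} (E - {{u, i}}))"
      have d: "degree ?E x = degree E x + (if x = r then 2 else 0)" for x
        using ub u n i degree_pos[OF fin u(1)] fin
        by (simp add: degree_insert degree_Diff doubleton_eq_iff)
      have "simple_graph {1..p} ?E"
        using ub u r i by (intro simple_graph_insert simple_graph_Diff G) auto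
      then have "subrealization p f r ?E"
        unfolding subrealization_def using le eq ind True i
        by (auto simp: d doubleton_eq_iff)
      then show False using no d[of r] by auto
    next
      case False
      then have d1: "f r = degree E r + 1" using def by simp
      \<comment> \<open>With deficit one at \<open>r\<close> alone, the sum of \<open>f\<close>
        would be one more than an even degree sum.\<close>
      have "\<exists>k. r < k \<and> k \<le> p \<and> degree E k < f k"
      proof (rule ccontr)
        assume "\<not> ?thesis"
        then have "f k = degree E k + (if k = r then 1 else 0)" if "k \<in> {1..p}" for k
          using that d1 le[of k] eq[of k] by (cases k r rule: linorder_cases) force+
        then have "(\<Sum>i=1..p. f i) = (\<Sum>i=1..p. degree E i) + 1"
          using r by (simp add: sum.distrib)
        then show False using ev sum_degree[OF G] by simp
      qed
      then obtain k where k: "r < k" "k \<le> p" "degree E k < f k" by blast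
      note kr = c0[OF k]
      have ku: "k \<noteq> u" "k \<noteq> i" using u kr k i by auto
      \<comment> \<open>Dropping \<open>{k, r}\<close> reduces the gain at \<open>r\<close> to one.
        The loss at \<open>k\<close> is harmless, since vertices after \<open>r\<close> may stay
        below \<open>f\<close>.\<close>
      let ?E = "insert {u, r} (insert {i, r} (E - {{u, i}} - {{k, r}}))"
      have d: "degree ?E x = degree E x + (if x = r then 1 else 0) - (if x = k then 1 else 0)" for x
        using ub u n i k ku kr degree_pos[OF fin u(1)] degree_pos[OF fin kr] fin
        by (simp add: degree_insert degree_Diff doubleton_eq_iff)
      have "simple_graph {1..p} ?E"
        using ub u r i by (intro simple_graph_insert simple_graph_Diff G) auto
      then have "subrealization p f r ?E"
        unfolding subrealization_def using le eq ind d1 i k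
        by (auto simp: d doubleton_eq_iff le_diff_conv intro: le_SucI)
      then show False using no d[of r] k by auto
    qed
  qed
  have c2: "degree E k = min r (f k)" if k: "r < k" "k \<le> p" for k
  proof (rule ccontr)
    assume neq: "degree E k \<noteq> min r (f k)"
    have nk: "nbrs E k \<subseteq> {1..r}"
      using ind[OF _ k(1)] edgeI by (force simp: nbrs_def not_less[symmetric])
    then have "degree E k \<le> r" using card_mono[OF _ nk] by (simp add: degree_eq_card_nbrs[OF G])
    then have lt: "degree E k < r" "degree E k < f k" using neq le[of k] k r by auto
    note kr = c0[OF k lt(2)]
    have "nbrs E k \<noteq> {1..r}" using lt(1) by (auto simp: degree_eq_card_nbrs[OF G])
    then obtain i where "i \<in> {1..r}" "i \<notin> nbrs E k" using nk by blast
    then have i: "1 \<le> i" "i \<le> r" "{i, k} \<notin> E" by (auto simp: nbrs_def)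
    then have ir: "i < r" using kr by (metis insert_commute nat_less_le)
    obtain u where u: "{u, i} \<in> E" "{u, r} \<notin> E" "u \<noteq> r"
      using exists_private_neighbour[OF G deg_less[OF i(1) ir]] by blast
    note ub = edgeI[OF u(1)]
    have ku: "k \<noteq> u" "k \<noteq> i" using u kr k i by auto
    \<comment> \<open>Both \<open>u\<close> and \<open>i\<close> trade one edge for another, while
      the two deficient vertices \<open>r\<close> and \<open>k\<close> gain one each.\<close>
    let ?E = "insert {u, r} (insert {i, k} (E - {{u, i}}))"
    have d: "degree ?E x = degree E x + (if x = r \<or> x = k then 1 else 0)" for x
      using ub u i ir k ku kr degree_pos[OF fin u(1)] fin
      by (simp add: degree_insert degree_Diff doubleton_eq_iff)
    have "simple_graph {1..p} ?E"
      using ub u r i k ku by (intro simple_graph_insert simple_graph_Diff G) auto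
    then have "subrealization p f r ?E"
      unfolding subrealization_def using le eq ind lt k ir def
      by (auto simp: d doubleton_eq_iff Suc_le_eq)
    then show False using no d[of r] by auto
  qed
  have c3: "{i, j} \<in> E" if ij: "1 \<le> i" "i < j" "j < r" for i j
  proof (rule ccontr)
    assume n: "{i, j} \<notin> E"
    have ir: "1 \<le> i" "i < r" and jr: "1 \<le> j" "j < r" using ij by auto
    obtain u where u: "{u, i} \<in> E" "{u, r} \<notin> E" "u \<noteq> r"
      using exists_private_neighbour[OF G deg_less[OF ir]] by blast
    obtain w where w: "{w, j} \<in> E" "{w, r} \<notin> E" "w \<noteq> r"
      using exists_private_neighbour[OF G deg_less[OF jr]] by blast
    note ub = edgeI[OF u(1)] and wb = edgeI[OF w(1)]
    \<comment> \<open>By \<open>c1\<close> every vertex before \<open>r\<close> is adjacent to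
      \<open>r\<close>, so \<open>u\<close> and \<open>w\<close> come after \<open>r\<close> and may
      lose degree.\<close>
    have gt: "r < u" "r < w" using c1[of u] c1[of w] u w ub wb by (metis linorder_neqE_nat)+
    \<comment> \<open>If \<open>u\<close> and \<open>w\<close> coincide, that vertex loses two
      edges; the bound keeps the subtraction on naturals from truncating.\<close>
    have two: "2 \<le> degree E u" if "w = u"
    proof -
      have "{i, j} \<subseteq> nbrs E u" using u w that by (auto simp: nbrs_def insert_commute)
      then have "card {i, j} \<le> card (nbrs E u)" by (rule card_mono[OF finite_nbrs[OF G]])
      then show ?thesis using ij by (simp add: degree_eq_card_nbrs[OF G])
    qed
    let ?E = "insert {i, j} (insert {u, r} (E - {{u, i}} - {{w, j}}))"
    have d: "degree ?E x = degree E x + (if x = r then 1 else 0) - (if x = w then 1 else 0)" for x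
      using ub wb u w ij n gt two degree_pos[OF fin u(1)] degree_pos[OF fin w(1)] fin
      by (auto simp add: degree_insert degree_Diff doubleton_eq_iff)
    have "simple_graph {1..p} ?E"
      using ub wb u r ij by (intro simple_graph_insert simple_graph_Diff G) auto
    then have "subrealization p f r ?E"
      unfolding subrealization_def using le eq ind def ij gt
      by (auto simp: d doubleton_eq_iff le_diff_conv Suc_le_eq intro: le_SucI)
    then show False using no d[of r] gt by auto
  qed
  have clique: "{i, j} \<in> E" if "i \<in> {1..r}" "j \<in> {1..r}" "i \<noteq> j" for i j
  proof -
    have *: "{a, b} \<in> E" if "1 \<le> a" "a < b" "b \<le> r" for a b
      using that c1[of a] c3[of a b] by (cases "b = r") auto
    from that consider "i < j" | "j < i" by linarith
    then show ?thesis using that *[of i j] *[of j i] by cases (auto simp: insert_commute)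
  qed
  have K: "{1..r} \<subseteq> {1..p}" using r by auto
  have "nbrs E v \<inter> {1..r} = {1..r} - {v}" if "v \<in> {1..r}" for v
  proof -
    have "{1..r} - {v} \<subseteq> nbrs E v" using clique[OF _ that] by (auto simp: nbrs_def)
    then show ?thesis using nbrs_subset[OF G] by blast
  qed
  then have A: "(\<Sum>v\<in>{1..r}. card (nbrs E v \<inter> {1..r})) = r * (r - 1)" by simp
  have "card (nbrs E v \<inter> {1..r}) = min r (f v)" if "v \<in> {r+1..p}" for v
  proof -
    have "nbrs E v \<inter> {1..r} = nbrs E v"
      using ind[of _ v] that edgeI by (force simp: nbrs_def not_less[symmetric])
    then show ?thesis using c2[of v] that by (simp add: degree_eq_card_nbrs[OF G])
  qed
  moreover have "{1..p} - {1..r} = {r+1..p}" using r by auto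
  ultimately have "(\<Sum>v\<in>{1..r}. degree E v) = r * (r - 1) + (\<Sum>i=r+1..p. min r (f i))"
    using sum_degree_split[OF G K] A by simp
  moreover have "(\<Sum>v\<in>{1..r}. degree E v) < (\<Sum>v\<in>{1..r}. f v)"
    by (rule sum_strict_mono_ex1) (use le def r in auto)
  ultimately show False using EG by simp
qed

text \<open>Iterates the step: the deficit at \<open>r\<close> drops strictly, and once it is zero
  \<open>r\<close> joins the saturated prefix.\<close>

lemma subrealization_fill:
  assumes anti: "\<And>i j. 1 \<le> i \<Longrightarrow> i \<le> j \<Longrightarrow> j \<le> p \<Longrightarrow> f j \<le> f i"
    and ev: "even (\<Sum>i=1..p. f i)"
    and EG: "(\<Sum>i=1..r. f i) \<le> r * (r - 1) + (\<Sum>i=r+1..p. min r (f i))"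
    and r: "1 \<le> r" "r \<le> p"
    and "subrealization p f r E"
  shows "\<exists>E'. subrealization p f (Suc r) E'"
  using \<open>subrealization p f r E\<close>
proof (induction "f r - degree E r" arbitrary: E rule: less_induct)
  case less
  show ?case
  proof (cases "degree E r < f r")
    case True
    then obtain E' where "subrealization p f r E'" "degree E r < degree E' r"
      using subrealization_step[OF anti ev EG r less.prems True] by blast
    then show ?thesis using less.hyps True by (meson diff_less_mono2)
  next
    case False
    then have "subrealization p f (Suc r) E"
      using less.prems r by (force simp: subrealization_def less_Suc_eq)
    then show ?thesis by blast
  qed
qed

text \<open>Starting from the edgeless graph, the vertices are saturated in order; the inequality
  for \<open>k\<close> is used while vertex \<open>k\<close> is filled.\<close>

theorem Erdos_Gallai_sufficient:
  fixes f :: "nat \<Rightarrow> nat"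
  assumes anti: "\<And>i j. 1 \<le> i \<Longrightarrow> i \<le> j \<Longrightarrow> j \<le> p \<Longrightarrow> f j \<le> f i"
    and ev: "even (\<Sum>i=1..p. f i)"
    and EG: "\<And>k. 1 \<le> k \<Longrightarrow> k \<le> p \<Longrightarrow>
      (\<Sum>i=1..k. f i) \<le> k * (k - 1) + (\<Sum>i=k+1..p. min k (f i))"
  shows "\<exists>E. simple_graph {1..p} E \<and> (\<forall>i\<in>{1..p}. degree E i = f i)"
proof -
  have "\<exists>E. subrealization p f (Suc q) E" if "q \<le> p" for q
    using that
  proof (induction q)
    case 0
    have "subrealization p f (Suc 0) {}"
      by (auto simp: subrealization_def simple_graph_def degree_def)
    then show ?case by blast
  next
    case (Suc q)
    then obtain E where "subrealization p f (Suc q) E" by auto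
    from subrealization_fill[OF anti ev EG _ _ this] show ?case using Suc.prems by simp
  qed
  then obtain E where "subrealization p f (Suc p) E" by blast
  then show ?thesis by (auto simp: subrealization_def)
qed

section \<open>Base sequences completed by twos\<close>

lemma sum_list_eq_sum_nth1:
  fixes s :: "'a::comm_monoid_add list"
  shows "sum_list s = (\<Sum>i=1..length s. s ! (i - 1))"
proof -
  have "sum_list s = (\<Sum>i=0..<length s. s ! i)" by (rule sum_list_sum_nth)
  also have "\<dots> = (\<Sum>i=1..length s. s ! (i - 1))"
    by (rule sum.reindex_bij_witness[where i = "\<lambda>i. i - 1" and j = Suc]) auto
  finally show ?thesis .
qed

lemma set_eq_image_nth1: "set s = (\<lambda>i. s ! (i - 1)) ` {1..length s}"
proof (intro equalityI subsetI)
  fix x assume "x \<in> set s"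
  then obtain i where "i < length s" "x = s ! i" by (metis in_set_conv_nth)
  then show "x \<in> (\<lambda>i. s ! (i - 1)) ` {1..length s}" by (intro image_eqI[of _ _ "Suc i"]) auto
qed auto

text \<open>Entries beyond position \<open>k\<close> enter only the sum of minima. For
  \<open>x = 2\<close> each new entry contributes \<open>min k 2\<close>, which explains the
  denominator in \<open>C_star\<close>.\<close>

lemma Delta_append_replicate:
  assumes "k \<le> length s"
  shows "Delta (s @ replicate c x) k = Delta s k + int c * int (min k x)"
proof -
  let ?t = "s @ replicate c x"
  have "{k + 1..length ?t} = {k + 1..length s} \<union> {length s + 1..length s + c}" using assms by auto
  then have "(\<Sum>i = k + 1..length ?t. int (min k (?t ! (i - 1)))) =
      (\<Sum>i\<in>{k + 1..length s}. int (min k (?t ! (i - 1)))) +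
      (\<Sum>i\<in>{length s + 1..length s + c}. int (min k (?t ! (i - 1))))"
    by (simp add: sum.union_disjoint del: length_append)
  also have "(\<Sum>i\<in>{k + 1..length s}. int (min k (?t ! (i - 1)))) =
      (\<Sum>i\<in>{k + 1..length s}. int (min k (s ! (i - 1))))"
    by (intro sum.cong) (auto simp: nth_append)
  also have "(\<Sum>i\<in>{length s + 1..length s + c}. int (min k (?t ! (i - 1)))) =
      (\<Sum>i\<in>{length s + 1..length s + c}. int (min k x))"
    by (intro sum.cong refl) (auto simp: nth_append)
  also have "\<dots> = int c * int (min k x)" by simp
  finally have "(\<Sum>i = k + 1..length ?t. int (min k (?t ! (i - 1)))) =
      (\<Sum>i = k + 1..length s. int (min k (s ! (i - 1)))) + int c * int (min k x)" .
  moreover have "(\<Sum>i = 1..k. int (?t ! (i - 1))) = (\<Sum>i = 1..k. int (s ! (i - 1)))"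
    using assms by (intro sum.cong) (auto simp: nth_append)
  ultimately show ?thesis by (simp add: Delta_def)
qed

lemma sorted_ge_nth_last_le:
  fixes s :: "'a::preorder list"
  assumes "sorted_wrt (\<ge>) s" "length s = Suc L" "x \<in> set s"
  shows "s ! L \<le> x"
proof -
  obtain i where "i < length s" "x = s ! i" using assms(3) by (metis in_set_conv_nth)
  then show ?thesis
    using sorted_wrt_nth_less[OF assms(1), of i L] assms(2) by (cases "i = L") auto
qed

lemma ceiling_div_min_le_iff:
  assumes "1 \<le> k"
  shows "\<lceil>- real_of_int z / real (min k 2)\<rceil> \<le> m \<longleftrightarrow> - z \<le> m * int (min k 2)"
proof -
  have "\<lceil>- real_of_int z / real (min k 2)\<rceil> \<le> m \<longleftrightarrow> - real_of_int z / real (min k 2) \<le> real_of_int m"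
    by (rule ceiling_le_iff)
  also have "\<dots> \<longleftrightarrow> - real_of_int z \<le> real_of_int m * real (min k 2)"
    by (rule pos_divide_le_eq) (use assms in simp)
  also have "\<dots> \<longleftrightarrow> real_of_int (- z) \<le> real_of_int (m * int (min k 2))" by simp
  finally show ?thesis by (simp only: of_int_le_iff)
qed

text \<open>Realizes \<open>s\<close> followed by \<open>c\<close> twos. As \<open>s\<close> already
  ends in 2, the sequence stays sorted and the degree set is unchanged. Bounds for
  \<open>k \<le> L\<close> suffice because all entries after position \<open>L\<close> are
  twos.\<close>

lemma exists_graph_append_twos:
  assumes sorted: "sorted_wrt (\<ge>) s" and len: "length s = Suc L" and L: "1 \<le> L"
    and last: "s ! L = 2" and ev: "even (sum_list s)"
    and c: "\<And>k. 1 \<le> k \<Longrightarrow> k \<le> L \<Longrightarrow> - Delta s k \<le> int c * int (min k 2)"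
  shows "\<exists>(V :: nat set) E. simple_graph V E \<and> degree_set V E = set s \<and> 2 * card E = sum_list s + 2 * c"
proof -
  define t where "t = s @ replicate c 2"
  define p where "p = length t"
  define f where "f i = t ! (i - 1)" for i
  have p: "p = Suc L + c" by (simp add: p_def t_def len)
  have ge2: "2 \<le> x" if "x \<in> set s" for x
    using sorted_ge_nth_last_le[OF sorted len that] last by simp
  have sorted_t: "sorted_wrt (\<ge>) t"
  proof -
    have "sorted_wrt (\<ge>) (replicate c (2::nat))" by (induction c) auto
    then show ?thesis using sorted ge2 by (auto simp: t_def sorted_wrt_append)
  qed
  have anti: "f j \<le> f i" if "1 \<le> i" "i \<le> j" "j \<le> p" for i j
    using sorted_wrt_nth_less[OF sorted_t, of "i - 1" "j - 1"] that
    by (cases "i = j") (auto simp: f_def p_def)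
  have sum_f: "(\<Sum>i=1..p. f i) = sum_list s + 2 * c"
    using sum_list_eq_sum_nth1[of t] by (simp add: f_def p_def t_def sum_list_replicate)
  have low: "0 \<le> Delta t k" if "1 \<le> k" "k \<le> L" for k
    using c[OF that] that len Delta_append_replicate[of k s c 2] by (simp add: t_def)
  define S where "S = (\<Sum>i=1..L. int (f i))"
  have f2: "f i = 2" if "L < i" "i \<le> p" for i
    using that last len by (cases "i = Suc L") (auto simp: f_def t_def p nth_append)
  \<comment> \<open>Once \<open>k\<close> reaches both 2 and \<open>L\<close>, every remaining
    minimum is 2, so \<open>Delta t k\<close> is an explicit quadratic in \<open>k\<close>.\<close>
  have closed: "Delta t k = int k * (int k - 1) + 2 * (int p - int k) - 2 * (int k - int L) - S"
    if k: "2 \<le> k" "L \<le> k" "k \<le> p" for k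
  proof -
    have "(\<Sum>i = k + 1..p. int (min k (f i))) = (\<Sum>i = k + 1..p. 2)"
      using k f2 by (intro sum.cong) auto
    also have "\<dots> = 2 * (int p - int k)" using k by simp
    finally have A: "(\<Sum>i = k + 1..p. int (min k (f i))) = 2 * (int p - int k)" .
    have "{1..k} = {1..L} \<union> {L + 1..k}" using k by auto
    then have "(\<Sum>i = 1..k. int (f i)) = S + (\<Sum>i = L + 1..k. int (f i))"
      by (simp add: S_def sum.union_disjoint)
    also have "(\<Sum>i = L + 1..k. int (f i)) = (\<Sum>i = L + 1..k. 2)"
      using k f2 by (intro sum.cong) auto
    also have "\<dots> = 2 * (int k - int L)" using k by simp
    finally show ?thesis using A unfolding Delta_def f_def p_def by simp
  qed
  have nonneg: "0 \<le> Delta t k" if k: "1 \<le> k" "k \<le> p" for k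
  proof (cases "k \<le> L")
    case True
    then show ?thesis using low k by simp
  next
    case False
    show ?thesis
    \<comment> \<open>For \<open>L = 1\<close> the factor \<open>k + L - 5\<close> used below can be
      negative, so \<open>c \<ge> f 1 - 1\<close> and the product of two consecutive integers are
      used instead.\<close>
    proof (cases "L = 1")
      case True
      have "Delta s 1 = 1 - int (f 1)"
        using len True last by (simp add: Delta_def f_def t_def nth_append numeral_2_eq_2)
      then have "int (f 1) - 1 \<le> int c" using c[of 1] L by simp
      moreover have "2 \<le> f 1" using ge2[of "f 1"] len by (simp add: f_def t_def nth_append)
      moreover have "0 \<le> (int k - 2) * (int k - 3)"
        using False True by (cases "k = 2") auto
      moreover have "Delta t k = (int k - 2) * (int k - 3) + 2 * int c - int (f 1)"
        using closed[of k] False k True by (simp add: S_def p algebra_simps)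
      ultimately show ?thesis by linarith
    next
      case L1: False
      have "Delta t k - Delta t L = (int k - int L) * (int k + int L - 5)"
        using closed[of k] closed[of L] False k L L1 p by (simp add: algebra_simps)
      moreover have "0 \<le> \<dots>" using False L L1 by (intro mult_nonneg_nonneg) auto
      ultimately show ?thesis using low[of L] L by simp
    qed
  qed
  have EG: "(\<Sum>i=1..k. f i) \<le> k * (k - 1) + (\<Sum>i=k+1..p. min k (f i))" if "1 \<le> k" "k \<le> p" for k
  proof -
    have "int (\<Sum>i=1..k. f i) \<le> int (k * (k - 1) + (\<Sum>i=k+1..p. min k (f i)))"
      using nonneg[OF that] that
      by (simp add: Delta_def f_def p_def of_nat_diff)
    then show ?thesis by linarith
  qed
  obtain E where E: "simple_graph {1..p} E" "\<forall>i\<in>{1..p}. degree E i = f i"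
    using Erdos_Gallai_sufficient[of p f, OF anti _ EG] ev sum_f by auto
  have "degree_set {1..p} E = f ` {1..p}" using E(2) by (simp add: degree_set_def)
  also have "\<dots> = set t" unfolding f_def p_def by (rule set_eq_image_nth1[symmetric])
  also have "\<dots> = set s"
    using nth_mem[of L s] len last by (auto simp: t_def)
  finally have "degree_set {1..p} E = set s" .
  moreover have "2 * card E = sum_list s + 2 * c"
    using sum_degree[OF E(1)] E(2) sum_f by simp
  ultimately show ?thesis using E(1) by blast
qed

section \<open>Lower bound on the number of edges\<close>

text \<open>Only \<open>s ! (i - 1) \<le> degree E (g i)\<close> is assumed, since the additional odd degree in the case of odd
  \<open>\<sigma>(D)\<close> may exceed \<open>d\<^sub>r\<close>; as \<open>min k\<close> is 1-Lipschitz, the excess counts no more than extra vertices do.\<close>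

lemma ceiling_Delta_le:
  assumes G: "simple_graph V E"
    and inj: "inj_on g {1..length s}" and gV: "g ` {1..length s} \<subseteq> V"
    and dom: "\<And>i. i \<in> {1..length s} \<Longrightarrow> s ! (i - 1) \<le> degree E (g i)"
    and ge2: "\<And>v. v \<in> V \<Longrightarrow> 2 \<le> degree E v"
    and pos: "\<And>x. x \<in> set s \<Longrightarrow> 0 < x"
    and m: "2 * int (card E) = int (sum_list s) + 2 * m"
    and k: "1 \<le> k" "k \<le> length s"
  shows "\<lceil>- real_of_int (Delta s k) / real (min k 2)\<rceil> \<le> m"
proof -
  define N where "N = length s"
  define a where "a i = int (s ! (i - 1))" for i
  define b where "b i = int (degree E (g i))" for i
  define X where "X = V - g ` {1..N}"
  have fin: "finite V" using G by (simp add: simple_graph_def)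
  have ab: "a i \<le> b i" "1 \<le> a i" if "i \<in> {1..N}" for i
    using dom[of i] pos[OF nth_mem, of "i - 1"] that by (auto simp: a_def b_def N_def Suc_le_eq)
  have injk: "inj_on g {1..k}" "inj_on g {k+1..N}"
    using inj k by (auto intro: inj_on_subset simp: N_def)
  have disj: "g ` {1..k} \<inter> g ` {k+1..N} = {}"
    using inj k unfolding N_def by (fastforce simp: inj_on_def)
  have ivl: "{1..N} = {1..k} \<union> {k+1..N}" using k unfolding N_def by auto
  have split: "g ` {1..N} = g ` {1..k} \<union> g ` {k+1..N}" unfolding ivl by (rule image_Un)
  have VK: "V - g ` {1..k} = g ` {k+1..N} \<union> X"
    using gV[folded N_def] disj split unfolding X_def by blast
  have "(\<Sum>v\<in>g ` {1..k}. degree E v) \<le> k * (k - 1) + (\<Sum>v\<in>V - g ` {1..k}. min k (degree E v))"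
    using sum_degree_le[OF G, of "g ` {1..k}"] gV k card_image[OF injk(1)] by force
  also have "(\<Sum>v\<in>V - g ` {1..k}. min k (degree E v)) =
      (\<Sum>i=k+1..N. min k (degree E (g i))) + (\<Sum>v\<in>X. min k (degree E v))"
    unfolding VK using fin split injk(2)
    by (subst sum.union_disjoint) (auto simp: X_def sum.reindex)
  finally have "int (\<Sum>v\<in>g ` {1..k}. degree E v) \<le> int (k * (k - 1) +
      ((\<Sum>i=k+1..N. min k (degree E (g i))) + (\<Sum>v\<in>X. min k (degree E v))))"
    by (simp only: of_nat_le_iff)
  then have main: "(\<Sum>i=1..k. b i) \<le> int k * (int k - 1) + (\<Sum>i=k+1..N. min (int k) (b i))
      + (\<Sum>v\<in>X. min (int k) (int (degree E v)))"
    using k injk(1) by (simp add: b_def sum.reindex of_nat_diff of_nat_min)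
  have Delta: "Delta s k = int k * (int k - 1) + (\<Sum>i=k+1..N. min (int k) (a i)) - (\<Sum>i=1..k. a i)"
    by (simp add: Delta_def a_def N_def of_nat_min)
  have sum_split: "(\<Sum>i=1..N. h i) = (\<Sum>i=1..k. h i) + (\<Sum>i=k+1..N. h i)" for h :: "nat \<Rightarrow> int"
    unfolding ivl by (rule sum.union_disjoint) auto
  have "2 * int (card E) = int (\<Sum>v\<in>V. degree E v)" using sum_degree[OF G] by simp
  also have "V = g ` {1..N} \<union> X" using gV unfolding X_def N_def by auto
  also have "(\<Sum>v\<in>g ` {1..N} \<union> X. degree E v) = (\<Sum>v\<in>g ` {1..N}. degree E v) + (\<Sum>v\<in>X. degree E v)"
    by (rule sum.union_disjoint) (use fin in \<open>auto simp: X_def\<close>)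
  finally have "2 * int (card E) = (\<Sum>i=1..N. b i) + (\<Sum>v\<in>X. int (degree E v))"
    using inj by (simp add: b_def sum.reindex N_def)
  moreover have "int (sum_list s) = (\<Sum>i=1..N. a i)"
    by (simp add: sum_list_eq_sum_nth1 a_def N_def)
  \<comment> \<open>The surplus \<open>2 * m\<close> splits into the excess on the first
    \<open>k\<close> entries, the excess on the later ones, and the degrees of the vertices in
    \<open>X\<close>.\<close>
  ultimately have m2: "2 * m = ((\<Sum>i=1..k. b i) - (\<Sum>i=1..k. a i))
      + ((\<Sum>i=k+1..N. b i) - (\<Sum>i=k+1..N. a i)) + (\<Sum>v\<in>X. int (degree E v))"
    using m sum_split[of a] sum_split[of b] by simp
  have le1: "(\<Sum>i=1..k. a i) \<le> (\<Sum>i=1..k. b i)"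
    by (rule sum_mono) (use ab k in \<open>auto simp: N_def\<close>)
  have le2: "(\<Sum>i=k+1..N. a i) \<le> (\<Sum>i=k+1..N. b i)"
    by (rule sum_mono) (use ab k in \<open>auto simp: N_def\<close>)
  have "- Delta s k \<le> m * int (min k 2)"
  proof (cases "k = 1")
    case True
    \<comment> \<open>For \<open>k = 1\<close> all these minima are 1, and a vertex of
      \<open>X\<close> contributes 1 while costing at least 2; this gains the factor two over the
      other case.\<close>
    have "(\<Sum>i=k+1..N. min (int k) (b i)) = (\<Sum>i=k+1..N. min (int k) (a i))"
    proof (rule sum.cong)
      fix i assume "i \<in> {k+1..N}"
      then have "a i \<le> b i" "1 \<le> a i" using ab[of i] by auto
      then show "min (int k) (b i) = min (int k) (a i)" using True by simp
    qed simp
    moreover have "2 * (\<Sum>v\<in>X. min (int k) (int (degree E v))) \<le> (\<Sum>v\<in>X. int (degree E v))"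
      unfolding sum_distrib_left
    proof (rule sum_mono)
      fix v assume "v \<in> X"
      then have "2 \<le> degree E v" using ge2 by (simp add: X_def)
      then show "2 * min (int k) (int (degree E v)) \<le> int (degree E v)" using True by simp
    qed
    ultimately have "- Delta s k \<le> m" using main Delta m2 le1 le2 by linarith
    then show ?thesis using True by simp
  next
    case False
    have "(\<Sum>i=k+1..N. min (int k) (b i)) \<le> (\<Sum>i=k+1..N. min (int k) (a i) + (b i - a i))"
    proof (rule sum_mono)
      fix i assume "i \<in> {k+1..N}"
      then have "a i \<le> b i" using ab[of i] by auto
      then show "min (int k) (b i) \<le> min (int k) (a i) + (b i - a i)" by simp
    qed
    then have "(\<Sum>i=k+1..N. min (int k) (b i)) \<le>
        (\<Sum>i=k+1..N. min (int k) (a i)) + ((\<Sum>i=k+1..N. b i) - (\<Sum>i=k+1..N. a i))"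
      by (simp add: sum.distrib sum_subtractf)
    moreover have "(\<Sum>v\<in>X. min (int k) (int (degree E v))) \<le> (\<Sum>v\<in>X. int (degree E v))"
      by (intro sum_mono) simp
    ultimately have "- Delta s k \<le> 2 * m" using main Delta m2 le1 by linarith
    moreover have "min k 2 = 2" using False k by simp
    ultimately show ?thesis by simp
  qed
  then show ?thesis using ceiling_div_min_le_iff[OF k(1)] by blast
qed

text \<open>Joins the two bounds for both parities at once. The hypothesis \<open>dom\<close>
  isolates what depends on the parity: every graph with this degree set contains distinct vertices
  whose degrees dominate \<open>s\<close>.\<close>

lemma ell_q_eq_of_base_seq:
  assumes sorted: "sorted_wrt (\<ge>) s" and len: "length s = Suc L" and L: "1 \<le> L"
    and last: "s ! L = 2" and ev: "even (sum_list s)" and first: "L \<le> s ! 0"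
    and dom: "\<And>(V :: nat set) E. simple_graph V E \<Longrightarrow> degree_set V E = set s \<Longrightarrow>
      \<exists>g. inj_on g {1..length s} \<and> g ` {1..length s} \<subseteq> V \<and>
        (\<forall>i\<in>{1..length s}. s ! (i - 1) \<le> degree E (g i))"
  shows "real (ell_q (set s)) = real (sum_list s) / 2 +
    real_of_int (Max ((\<lambda>k. \<lceil>- real_of_int (Delta s k) / real (min k 2)\<rceil>) ` {1..L}))"
proof -
  let ?q = "\<lambda>k. \<lceil>- real_of_int (Delta s k) / real (min k 2)\<rceil>"
  define C where "C = Max (?q ` {1..L})"
  have qC: "?q k \<le> C" if "1 \<le> k" "k \<le> L" for k
    unfolding C_def by (rule Max_ge) (use that in auto)
  have ge2: "2 \<le> x" if "x \<in> set s" for x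
    using sorted_ge_nth_last_le[OF sorted len that] last by simp
  have "(\<Sum>i = 2..length s. int (min 1 (s ! (i - 1)))) = (\<Sum>i = 2..length s. 1)"
  proof (rule sum.cong)
    fix i assume "i \<in> {2..length s}"
    then have "2 \<le> s ! (i - 1)" by (intro ge2 nth_mem) auto
    then show "int (min 1 (s ! (i - 1))) = 1" by simp
  qed simp
  \<comment> \<open>With \<open>first\<close>, the term for \<open>k = 1\<close> makes the maximum
    \<open>C\<close> nonnegative, so \<open>nat C\<close> can serve as the number of appended
    twos.\<close>
  then have "- Delta s 1 = int (s ! 0) - int L" by (simp add: Delta_def len numeral_2_eq_2)
  then have "0 \<le> - real_of_int (Delta s 1) / real (min 1 2)" using first by simp
  then have "0 \<le> ?q 1" by (simp add: le_ceiling_iff)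
  then have C0: "0 \<le> C" using qC[of 1] L by linarith
  have "- Delta s k \<le> int (nat C) * int (min k 2)" if "1 \<le> k" "k \<le> L" for k
    using qC[OF that] ceiling_div_min_le_iff[OF that(1), of "Delta s k" C] C0 by simp
  then obtain V :: "nat set" and E where VE: "simple_graph V E" "degree_set V E = set s"
      "2 * card E = sum_list s + 2 * nat C"
    using exists_graph_append_twos[OF sorted len L last ev, of "nat C"] by blast
  have upper: "ell_q (set s) \<le> card E" using ell_q_le[OF VE(1)] VE(2) by simp
  obtain V' :: "nat set" and E' where V'E': "simple_graph V' E'" "degree_set V' E' = set s"
      "card E' = ell_q (set s)"
    using ell_q_attained[OF VE(1)] VE(2) by auto
  obtain g where g: "inj_on g {1..length s}" "g ` {1..length s} \<subseteq> V'"
      "\<And>i. i \<in> {1..length s} \<Longrightarrow> s ! (i - 1) \<le> degree E' (g i)"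
    using dom[OF V'E'(1,2)] by blast
  \<comment> \<open>Half the surplus of a minimal graph over \<open>s\<close>; the division is exact
    because \<open>sum_list s\<close> is even.\<close>
  define m where "m = int (card E') - int (sum_list s div 2)"
  have m: "2 * int (card E') = int (sum_list s) + 2 * m" using ev by (auto simp: m_def)
  have "2 \<le> degree E' v" if "v \<in> V'" for v
    using ge2 V'E'(2) that by (auto simp: degree_set_def)
  moreover have "0 < x" if "x \<in> set s" for x using ge2[OF that] by simp
  ultimately have "?q k \<le> m" if "k \<in> {1..L}" for k
    using ceiling_Delta_le[OF V'E'(1) g _ _ m, of k] that len by simp
  then have "C \<le> m" unfolding C_def using L by (intro Max.boundedI) auto
  then have "2 * int (ell_q (set s)) = int (sum_list s) + 2 * C"
    using m upper VE(3) V'E'(3) C0 by linarith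
  then have "real_of_int (2 * int (ell_q (set s))) = real_of_int (int (sum_list s) + 2 * C)" by simp
  then show ?thesis unfolding C_def by simp
qed

section \<open>The base sequence for each parity of \<open>sigma D\<close>\<close>

lemma exists_vertices_of_degrees:
  assumes "degree_set V E = d ` I" and "inj_on d I"
  obtains v where "inj_on v I" "v ` I \<subseteq> V" "\<And>i. i \<in> I \<Longrightarrow> degree E (v i) = d i"
proof -
  have "\<forall>i\<in>I. \<exists>v. v \<in> V \<and> degree E v = d i"
    using assms(1) by (force simp: degree_set_def)
  then obtain v where v: "\<And>i. i \<in> I \<Longrightarrow> v i \<in> V \<and> degree E (v i) = d i" by metis
  moreover have "inj_on v I" using v assms(2) by (metis inj_on_def)
  ultimately show thesis using that by blast
qed

theorem theorem5:
  fixes D :: "nat set" and d :: "nat \<Rightarrow> nat" and n :: nat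
  assumes "n \<ge> 2"
    and "D = d ` {1..n}"
    and "\<And>x. x \<in> D \<Longrightarrow> 0 < x"
    and "\<And>i j. 1 \<le> i \<Longrightarrow> i < j \<Longrightarrow> j \<le> n \<Longrightarrow> d i > d j"
    and "Min D = d n"
    and "d n = 2"
  shows "real (ell_q D) = (real (sigma D) + 2 * real_of_int (C_star d n)) / 2
           + (if even (sigma D) then 0 else real (d (last_odd d n)) / 2)"
proof -
  note dec = assms(4)
  have dec_le: "d j \<le> d i" if "1 \<le> i" "i \<le> j" "j \<le> n" for i j
    using dec[of i j] that by (cases "i = j") auto
  have inj: "inj_on d {1..n}"
    by (rule linorder_inj_onI) (use dec in \<open>fastforce+\<close>)
  have sigma: "sigma D = (\<Sum>i=1..n. d i)"
    unfolding sigma_def assms(2) using sum.reindex[OF inj, of "\<lambda>x. x"] by simp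
  \<comment> \<open>Counting the \<open>n\<close> distinct values in this interval bounds the first
    entry from below, as \<open>ell_q_eq_of_base_seq\<close> requires.\<close>
  have "d ` {1..n} \<subseteq> {2..d 1}" using dec_le assms(6) by fastforce
  then have "card (d ` {1..n}) \<le> card {2..d 1}" by (intro card_mono) auto
  then have n: "n \<le> d 1" using card_image[OF inj] by simp
  show ?thesis
  proof (cases "even (sigma D)")
    case True
    define s where "s = seq_even d n"
    have len: "length s = n" by (simp add: s_def seq_even_def)
    have nth: "s ! (i - 1) = d i" if "i \<in> {1..n}" for i
      using that by (cases i) (auto simp: s_def seq_even_def simp del: upt_Suc)
    have set_s: "set s = D" by (auto simp: s_def seq_even_def assms(2))
    have sum: "sum_list s = sigma D"
      unfolding sum_list_eq_sum_nth1 sigma len by (intro sum.cong) (use nth in auto)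
    have eq: "real (ell_q (set s)) = real (sum_list s) / 2 +
      real_of_int (Max ((\<lambda>k. \<lceil>- real_of_int (Delta s k) / real (min k 2)\<rceil>) ` {1..n - 1}))"
    proof (rule ell_q_eq_of_base_seq)
      show "sorted_wrt (\<ge>) s"
        unfolding sorted_wrt_iff_nth_less
      proof (intro allI impI)
        fix i j assume "i < j" "j < length s"
        then show "s ! j \<le> s ! i"
          using nth[of "Suc i"] nth[of "Suc j"] dec_le[of "Suc i" "Suc j"] len by simp
      qed
      show "length s = Suc (n - 1)" "1 \<le> n - 1" using len assms(1) by auto
      show "s ! (n - 1) = 2" using nth[of n] assms by simp
      show "even (sum_list s)" using True sum by simp
      show "n - 1 \<le> s ! 0" using nth[of 1] assms(1) n by simp
      fix V :: "nat set" and E assume "simple_graph V E" "degree_set V E = set s"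
      then obtain v where "inj_on v {1..n}" "v ` {1..n} \<subseteq> V"
          "\<And>i. i \<in> {1..n} \<Longrightarrow> degree E (v i) = d i"
        using exists_vertices_of_degrees[OF _ inj] set_s assms(2) by metis
      then show "\<exists>g. inj_on g {1..length s} \<and> g ` {1..length s} \<subseteq> V \<and>
          (\<forall>i\<in>{1..length s}. s ! (i - 1) \<le> degree E (g i))"
        using nth unfolding len by (intro exI[of _ v]) simp
    qed
    have "C_star d n = Max ((\<lambda>k. \<lceil>- real_of_int (Delta s k) / real (min k 2)\<rceil>) ` {1..n - 1})"
      using True unfolding C_star_def s_def assms(2) by presburger
    then show ?thesis using eq[unfolded set_s sum] True by simp
  next
    case False
    define r where "r = last_odd d n"
    have "\<exists>i\<in>{1..n}. odd (d i)"
    proof (rule ccontr)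
      assume "\<not> ?thesis"
      then have "even (\<Sum>i=1..n. d i)" by (intro dvd_sum) auto
      then show False using False sigma by simp
    qed
    then have "r \<in> {i \<in> {1..n}. odd (d i)}"
      unfolding r_def last_odd_def by (intro Max_in) auto
    then have r: "1 \<le> r" "r \<le> n" "odd (d r)" by auto
    have r_max: "j \<le> r" if "j \<in> {1..n}" "odd (d j)" for j
      unfolding r_def last_odd_def by (intro Max_ge) (use that in auto)
    \<comment> \<open>Since \<open>d n = 2\<close> is even, the repeated entry is not the last one,
      and \<open>s\<close> still ends in \<open>d n\<close>.\<close>
    have rn: "r < n" using r assms(6) by (cases "r = n") auto
    define s where "s = seq_odd d n"
    have s: "s = map d ([1..<r] @ [r, r] @ [r + 1..<n + 1])"
      by (simp add: s_def seq_odd_def r_def numeral_2_eq_2 Let_def)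
    have len: "length s = Suc n" using r by (simp add: s del: upt_Suc)
    \<comment> \<open>Position \<open>r + 1\<close> holds the second copy of \<open>d r\<close>, and
      everything behind it is shifted by one. The length is now \<open>n + 1\<close>, so
      \<open>k\<close> ranges up to \<open>n\<close> instead of \<open>n - 1\<close>.\<close>
    have nth: "s ! (i - 1) = d (if i \<le> r then i else i - 1)" if i: "i \<in> {1..Suc n}" for i
    proof -
      consider "i < r" | "i = r" | "i = r + 1" | "r + 1 < i" by linarith
      then show ?thesis
        using i r by cases (auto simp: s nth_append nth_Cons' simp del: upt_Suc intro!: arg_cong[where f = d])
    qed
    have set_s: "set s = D"
    proof -
      have "set ([1..<r] @ [r, r] @ [r + 1..<n + 1]) = {1..n}" using r by auto
      then show ?thesis unfolding s assms(2) by (metis list.set_map)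
    qed
    have sum: "sum_list s = sigma D + d r"
    proof -
      have "[1..<n + 1] = [1..<r] @ [r..<n + 1]"
        using r upt_add_eq_append[of 1 r "n + 1 - r"] by (simp del: upt_Suc)
      also have "[r..<n + 1] = r # [r + 1..<n + 1]" using r by (simp add: upt_conv_Cons del: upt_Suc)
      finally have "sum_list (map d [1..<n + 1]) + d r = sum_list s"
        by (simp add: s del: upt_Suc)
      moreover have "sum_list (map d [1..<n + 1]) = sigma D"
        unfolding sigma
        by (simp add: interv_sum_list_conv_sum_set_nat atLeastLessThanSuc_atLeastAtMost del: upt_Suc)
      ultimately show ?thesis by simp
    qed
    have ev: "even (sum_list s)" using False r sum by simp
    have eq: "real (ell_q (set s)) = real (sum_list s) / 2 +
      real_of_int (Max ((\<lambda>k. \<lceil>- real_of_int (Delta s k) / real (min k 2)\<rceil>) ` {1..n}))"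
    proof (rule ell_q_eq_of_base_seq)
      show "sorted_wrt (\<ge>) s"
        unfolding sorted_wrt_iff_nth_less
      proof (intro allI impI)
        fix i j assume "i < j" "j < length s"
        then show "s ! j \<le> s ! i"
          using nth[of "Suc i"] nth[of "Suc j"] r len by (auto intro!: dec_le)
      qed
      show "length s = Suc n" "1 \<le> n" using len assms(1) by auto
      show "s ! n = 2" using nth[of "Suc n"] rn assms by simp
      show "even (sum_list s)" by (rule ev)
      show "n \<le> s ! 0" using nth[of 1] r n by simp
      fix V :: "nat set" and E assume G: "simple_graph V E" and deg: "degree_set V E = set s"
      obtain v where v: "inj_on v {1..n}" "v ` {1..n} \<subseteq> V"
          "\<And>i. i \<in> {1..n} \<Longrightarrow> degree E (v i) = d i"
        using exists_vertices_of_degrees[OF _ inj] deg set_s assms(2) by metis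
      \<comment> \<open>The chosen vertices have odd degree sum \<open>sigma D\<close>, whereas the
        total is even.\<close>
      have "\<exists>w\<in>V - v ` {1..n}. odd (degree E w)"
      proof (rule ccontr)
        assume "\<not> ?thesis"
        then have "even (\<Sum>w\<in>V - v ` {1..n}. degree E w)" by (intro dvd_sum) auto
        moreover have "(\<Sum>w\<in>v ` {1..n}. degree E w) = sigma D"
          unfolding sigma sum.reindex[OF v(1)] by (intro sum.cong) (use v(3) in auto)
        moreover have "(\<Sum>w\<in>V. degree E w) =
            (\<Sum>w\<in>V - v ` {1..n}. degree E w) + (\<Sum>w\<in>v ` {1..n}. degree E w)"
          by (rule sum.subset_diff) (use v(2) G in \<open>auto simp: simple_graph_def\<close>)
        ultimately show False using sum_degree[OF G] False by (metis dvd_triv_left even_add)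
      qed
      then obtain w where w: "w \<in> V" "w \<notin> v ` {1..n}" "odd (degree E w)" by blast
      have "degree E w \<in> d ` {1..n}"
        using w(1) deg set_s assms(2) unfolding degree_set_def by blast
      then obtain j where j: "j \<in> {1..n}" "degree E w = d j" by blast
      \<comment> \<open>As \<open>d\<close> decreases, the last odd index \<open>r\<close> carries
        the smallest odd element of \<open>D\<close>.\<close>
      then have wr: "d r \<le> degree E w" using r_max[of j] w(3) dec_le[of j r] r by simp
      \<comment> \<open>The additional vertex \<open>w\<close> takes the place of the second copy of
        \<open>d r\<close>.\<close>
      define g where "g i = (if i \<le> r then v i else if i = Suc r then w else v (i - 1))" for i
      have "inj_on g {1..Suc n}"
      proof (rule linorder_inj_onI)
        fix i j assume ij: "i < j" "i \<in> {1..Suc n}" "j \<in> {1..Suc n}"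
        have vne: "v a \<noteq> v b" if "1 \<le> a" "a < b" "b \<le> n" for a b
          using inj_onD[OF v(1), of a b] that by auto
        have wne: "w \<noteq> v a" if "1 \<le> a" "a \<le> n" for a using w(2) that by auto
        show "g i \<noteq> g j"
          using ij r rn vne[of i j] vne[of i "j - 1"] vne[of "i - 1" "j - 1"]
            wne[of i] wne[of "j - 1"]
          by (auto simp: g_def)
      qed auto
      moreover have "g ` {1..Suc n} \<subseteq> V"
      proof (rule image_subsetI)
        fix i assume "i \<in> {1..Suc n}"
        then have "i \<le> r \<Longrightarrow> i \<in> {1..n}" "r < i \<Longrightarrow> i - 1 \<in> {1..n}" using r by auto
        then show "g i \<in> V" using v(2) w(1) by (auto simp: g_def image_subset_iff)
      qed
      moreover have "s ! (i - 1) \<le> degree E (g i)" if i: "i \<in> {1..Suc n}" for i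
      proof -
        have "i \<le> r \<Longrightarrow> i \<in> {1..n}" "r < i \<Longrightarrow> i - 1 \<in> {1..n}" using i r by auto
        then show ?thesis using nth[OF i] v(3)[of i] v(3)[of "i - 1"] wr by (auto simp: g_def)
      qed
      ultimately show "\<exists>g. inj_on g {1..length s} \<and> g ` {1..length s} \<subseteq> V \<and>
          (\<forall>i\<in>{1..length s}. s ! (i - 1) \<le> degree E (g i))"
        unfolding len by blast
    qed
    have "C_star d n = Max ((\<lambda>k. \<lceil>- real_of_int (Delta s k) / real (min k 2)\<rceil>) ` {1..n})"
      using False unfolding C_star_def s_def assms(2) by presburger
    then show ?thesis using eq[unfolded set_s sum] False by (simp add: r_def add_divide_distrib)
  qed
qed

end
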